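(* Let $X=\left\{\sum_{n=1}^{\infty}\frac{\alpha_n}{4^n} : \alpha_n\in\{0,2,3,5\}\text{ for all } n\ge 1\right\}\subset\mathbb{R}$ and let $X_C$ be the boundary of $X$ in $\mathbb{R}$. Then the Hausdorff dimension of $X_C$ is equal to its N-self-similar dimension: $\dim_H X_C=\alpha_*(X_C)$.
   Context: N-self-similar dimension (NSS-dimension): for a countable collection of similarities $f_1,f_2,\dots$ with ratios $k_1,k_2,\dots<1$ associated with a set $E$, the N-self-similar dimension $\alpha_*(E)$ is the solution $x$ of the equation $k_1^x+k_2^x+\dots+k_n^x+\dots=1$. For $E=X_C$ the collection of similarities consists, for each $n\ge 1$, of the two maps $x\mapsto \sum_{i=1}^{n-1}\frac{2}{4^i}+\frac{1}{4^n}x$ and $x\mapsto \frac53-\left(\sum_{i=1}^{n-1}\frac{2}{4^i}+\frac{1}{4^n}x\right)$, each of ratio $1/4^n$. Thus $\alpha_*(X_C)$ is the solution $x$ of $\sum_{n=1}^{\infty}2\left(\frac{1}{4^n}\right)^x=1$, that is, $\alpha_*(X_C)=\log_4 3$. $\dim_H$ denotes the usual Hausdorff dimension. *)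

theory Defs
  imports "HOL-Analysis.Analysis"
begin

text \<open>
  The term \<open>|U|^s\<close> in the Hausdorff sums. The case \<open>s = 0\<close> is separate because
  \<open>0 powr 0 = 0\<close>, whereas a nonempty set of diameter 0 has to count 1.
\<close>

definition diam_pow :: "real \<Rightarrow> 'a::metric_space set \<Rightarrow> ennreal" where
  "diam_pow s U =
     (if U = {} then 0 else if s = 0 then 1 else ennreal (diameter U powr s))"

text \<open>
  Covers are sequences of sets; finite covers are included by padding with empty sets.
  Boundedness is required since \<^const>\<open>diameter\<close> is meaningful for bounded sets only.
\<close>

definition hausdorff_premeasure :: "real \<Rightarrow> real \<Rightarrow> 'a::metric_space set \<Rightarrow> ennreal" where
  "hausdorff_premeasure s \<delta> E =
     (INF U \<in> {U :: nat \<Rightarrow> 'a set. E \<subseteq> (\<Union>i. U i) \<and> (\<forall>i. bounded (U i) \<and> diameter (U i) \<le> \<delta>)}.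
        \<Sum>i. diam_pow s (U i))"

definition hausdorff_measure :: "real \<Rightarrow> 'a::metric_space set \<Rightarrow> ennreal" where
  "hausdorff_measure s E = (SUP \<delta>\<in>{0<..}. hausdorff_premeasure s \<delta> E)"

definition hausdorff_dim :: "'a::metric_space set \<Rightarrow> ereal" where
  "hausdorff_dim E = Inf {ereal s | s. 0 \<le> s \<and> hausdorff_measure s E = 0}"

definition similarity_with :: "real \<Rightarrow> ('a::metric_space \<Rightarrow> 'a) \<Rightarrow> bool" where
  "similarity_with k f \<longleftrightarrow> 0 < k \<and> (\<forall>x y. dist (f x) (f y) = k * dist x y)"

definition similarity_ratio :: "('a::metric_space \<Rightarrow> 'a) \<Rightarrow> real" where
  "similarity_ratio f = (THE k. similarity_with k f)"

text \<open>
  The terms of the defining equation are nonnegative, so the order of summation is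
  immaterial and the unordered sum over the index set is used.
\<close>

definition nss_dim :: "'i set \<Rightarrow> ('i \<Rightarrow> 'a::metric_space \<Rightarrow> 'a) \<Rightarrow> real" where
  "nss_dim I f = (THE x. ((\<lambda>i. similarity_ratio (f i) powr x) has_sum 1) I)"

definition X_set :: "real set" where
  "X_set = {\<Sum>n. \<alpha> (Suc n) / 4 ^ Suc n | \<alpha> :: nat \<Rightarrow> real. \<forall>n\<ge>1. \<alpha> n \<in> {0, 2, 3, 5}}"

definition X_C :: "real set" where
  "X_C = frontier X_set"

definition X_C_index :: "(nat \<times> bool) set" where
  "X_C_index = {1..} \<times> UNIV"

definition X_C_sim :: "nat \<times> bool \<Rightarrow> real \<Rightarrow> real" where
  "X_C_sim = (\<lambda>(n, flip) x.
     let y = (\<Sum>i=1..n-1. 2 / 4 ^ i) + 1 / 4 ^ n * x in if flip then 5 / 3 - y else y)"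

definition alpha_star_X_C :: real where
  "alpha_star_X_C = nss_dim X_C_index X_C_sim"

lemma similarity_with_X_C_sim: "similarity_with (1 / 4 ^ n) (X_C_sim (n, b))"
proof -
  have "dist (X_C_sim (n, b) x) (X_C_sim (n, b) y) = 1 / 4 ^ n * dist x y" for x y
  proof -
    have "dist (X_C_sim (n, b) x) (X_C_sim (n, b) y) = \<bar>1 / 4 ^ n * (x - y)\<bar>"
      by (auto simp: X_C_sim_def Let_def dist_real_def right_diff_distrib diff_divide_distrib)
    then show ?thesis
      by (simp add: abs_mult dist_real_def)
  qed
  then show ?thesis
    by (simp add: similarity_with_def)
qed

lemma similarity_ratio_eq:
  fixes f :: "real \<Rightarrow> real"
  assumes "similarity_with k f"
  shows "similarity_ratio f = k"
  unfolding similarity_ratio_def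
proof (rule the_equality)
  show "similarity_with k f" by (rule assms)
next
  fix k' assume "similarity_with k' f"
  with assms have "k' * dist 0 (1::real) = k * dist 0 (1::real)"
    unfolding similarity_with_def by metis
  then show "k' = k" by simp
qed

lemma X_C_ratio: "similarity_ratio (X_C_sim (n, b)) = 1 / 4 ^ n"
  by (rule similarity_ratio_eq[OF similarity_with_X_C_sim])

lemma X_C_nss_equation_iff:
  "((\<lambda>i. similarity_ratio (X_C_sim i) powr x) has_sum 1) X_C_index \<longleftrightarrow> x = log 4 3"
proof -
  define r :: real where "r = (1 / 4) powr x"
  have r: "r > 0" by (simp add: r_def)
  have pw: "similarity_ratio (X_C_sim (n, b)) powr x = r ^ n" for n b
  proof -
    have "(1 / 4 ^ n :: real) powr x = ((1 / 4) powr real n) powr x"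
      by (simp add: powr_realpow power_one_over)
    also have "\<dots> = ((1 / 4) powr x) powr real n"
      by (simp add: powr_powr mult.commute)
    also have "\<dots> = r ^ n"
      using r by (simp add: powr_realpow r_def)
    finally show ?thesis by (simp add: X_C_ratio)
  qed
  have eq: "(\<lambda>i. similarity_ratio (X_C_sim i) powr x) = (\<lambda>(n, b). r ^ n)"
    by (auto simp: pw)
  have geo: "((\<lambda>(n, b::bool). r ^ n) has_sum (2 * (r / (1 - r)))) X_C_index" if "r < 1"
  proof -
    have "(\<lambda>n. r ^ n) sums (1 / (1 - r))"
      using that r by (intro geometric_sums) auto
    then have "((\<lambda>n. r ^ n) has_sum (1 / (1 - r))) UNIV"
      using r by (intro sums_nonneg_imp_has_sum) auto
    then have "((\<lambda>n. r * r ^ n) has_sum (r * (1 / (1 - r)))) UNIV"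
      by (rule has_sum_cmult_right)
    then have "((\<lambda>n. r ^ n) \<circ> Suc has_sum (r / (1 - r))) UNIV"
      by (simp add: o_def)
    moreover have "range Suc = {1..}"
      by (auto simp: image_iff Suc_le_eq gr0_conv_Suc)
    ultimately have 1: "((\<lambda>n. r ^ n) has_sum (r / (1 - r))) {1..}"
      using has_sum_reindex[of Suc UNIV "\<lambda>n. r ^ n" "r / (1 - r)"]
      by simp
    have inj: "inj_on (\<lambda>n. (n, c)) A" for A :: "nat set" and c :: bool
      by (auto simp: inj_on_def)
    have 2: "((\<lambda>(n, b::bool). r ^ n) has_sum (r / (1 - r))) ((\<lambda>n. (n, c)) ` {1..})" for c
      using 1 by (subst has_sum_reindex[OF inj]) (simp add: o_def)
    have "((\<lambda>(n, b::bool). r ^ n) has_sum (r / (1 - r) + r / (1 - r)))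
            ((\<lambda>n. (n, True)) ` {1..} \<union> (\<lambda>n. (n, False)) ` {1..})"
      by (intro has_sum_Un_disjoint 2) auto
    moreover have "(\<lambda>n. (n, True)) ` {1..} \<union> (\<lambda>n. (n, False)) ` {1..} = X_C_index"
      unfolding X_C_index_def by auto
    ultimately show ?thesis by simp
  qed
  have r13: "r = 1 / 3 \<longleftrightarrow> x = log 4 3"
  proof -
    have "r = 1 / 3 \<longleftrightarrow> 4 powr x = 3"
      by (simp add: r_def powr_divide)
    also have "\<dots> \<longleftrightarrow> x = log 4 3"
      by (metis log_powr_cancel powr_log_cancel zero_less_numeral numeral_One
          numeral_eq_iff semiring_norm(83,85))
    finally show ?thesis .
  qed
  show ?thesis
  proof
    assume hs: "((\<lambda>i. similarity_ratio (X_C_sim i) powr x) has_sum 1) X_C_index"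
    have "r < 1"
    proof (rule ccontr)
      assume "\<not> r < 1"
      then have "r ^ n \<ge> 1" for n by simp
      then have "(\<Sum>i\<in>{1..2::nat} \<times> (UNIV::bool set). 1::real) \<le>
                 (\<Sum>(n, b)\<in>{1..2::nat} \<times> (UNIV::bool set). r ^ n)"
        by (intro sum_mono) auto
      also have "\<dots> \<le> 1"
        using hs[unfolded eq] r
        by (intro finite_sum_le_has_sum[where A = X_C_index]) (auto simp: X_C_index_def)
      finally show False by simp
    qed
    with geo hs have "1 = 2 * (r / (1 - r))"
      unfolding eq by (blast dest: has_sum_unique)
    then have "r = 1 / 3"
      using \<open>r < 1\<close> by (simp add: field_simps)
    with r13 show "x = log 4 3" by simp
  next
    assume "x = log 4 3"
    with r13 have r3: "r = 1 / 3" by simp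
    then have "2 * (r / (1 - r)) = 1" "r < 1" by simp_all
    with geo have "((\<lambda>(n, b::bool). r ^ n) has_sum 1) X_C_index" by metis
    then show "((\<lambda>i. similarity_ratio (X_C_sim i) powr x) has_sum 1) X_C_index"
      unfolding eq .
  qed
qed

lemma alpha_star_X_C_eq: "alpha_star_X_C = log 4 3"
  unfolding alpha_star_X_C_def nss_dim_def X_C_nss_equation_iff by simp

end

theory Submission
  imports Defs
begin

text \<open>
  Let \<open>C\<close> be the Cantor set of all \<open>\<Sum>n\<ge>1. c n / 4 ^ n\<close> with digits \<open>c n \<in> {0, 1, 2}\<close>. The
  boundary of \<open>X\<close> lies between \<open>C\<close> and \<open>C \<union> (C + 1)\<close>, and these sets have dimension
  \<open>log 4 3\<close>, which is the root of the equation defining the N-self-similar dimension.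

  The digits \<open>0, 2, 3, 5\<close> form a complete residue system modulo 4, so the integer translates of
  \<open>X\<close> cover the line (\<open>X_translates_cover\<close>). As \<open>X\<close> is closed and contained in \<open>[0, 5/3]\<close>, a
  boundary point of \<open>X\<close> also lies in \<open>X + 1\<close> or in \<open>X - 1\<close>. Following the digits of \<open>x\<close> and
  \<open>x + 1\<close> simultaneously gives \<open>X \<inter> (X - 1) = C\<close>
  (\<open>C_subset_X\<close>, \<open>X_Int_translate_subset_C\<close>), hence \<open>X_C \<subseteq> C \<union> (C + 1)\<close>. In the other
  direction, \<open>X\<close> is the closure of its interior, because it contains the interval \<open>(2/3, 1)\<close>
  and therefore small copies of this interval near each of its points. An interior point of \<open>X\<close>
  lying in \<open>C\<close> would then make \<open>X \<inter> (X - 1) = C\<close> have an interior point, but \<open>C\<close> has none; so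
  \<open>C \<subseteq> X_C\<close>.

  The upper bound for the dimension comes from covering \<open>C\<close> by \<open>3 ^ n\<close> intervals of length
  \<open>1 / 4 ^ n\<close>. For the lower bound, reading the digits of a point of \<open>C\<close> in base 3 maps \<open>C\<close> onto
  \<open>[0, 1]\<close> and is Hoelder continuous with exponent \<open>log 4 3\<close> (\<open>radix_hoelder\<close>). A cover of \<open>C\<close>
  is thus carried to a cover of \<open>[0, 1]\<close>, whose total length is at least 1, and this bounds
  the Hausdorff sums from below (\<open>cover_sum_ge\<close>).
\<close>

section \<open>Radix expansions\<close>

text \<open>
  The number \<open>0.c\<^sub>0c\<^sub>1c\<^sub>2\<dots>\<close> in base \<open>b\<close>; the digit \<open>c n\<close> has weight \<open>1 / b ^ (n + 1)\<close>.
  Digits are arbitrary reals.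
\<close>

definition radix :: "real \<Rightarrow> (nat \<Rightarrow> real) \<Rightarrow> real" where
  "radix b c = (\<Sum>n. c n / b ^ Suc n)"

text \<open>
  The numbers that have an expansion in base \<open>b\<close> with all digits in \<open>D\<close>. For finite
  nonempty \<open>D\<close> and \<open>b > 1\<close> this is the attractor of the maps \<open>\<lambda>y. (d + y) / b\<close> with \<open>d \<in> D\<close>.
\<close>

definition digit_set :: "real \<Rightarrow> real set \<Rightarrow> real set" where
  "digit_set b D = radix b ` {c. \<forall>n. c n \<in> D}"

lemma sums_geometric_Suc:
  fixes b m :: real
  assumes "b > 1"
  shows "(\<lambda>n. m / b ^ Suc n) sums (m / (b - 1))"
proof -
  have "(\<lambda>n. (m / b) * (1 / b) ^ n) sums ((m / b) * (1 / (1 - 1 / b)))"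
    using assms by (intro sums_mult geometric_sums) auto
  moreover have "(m / b) * (1 / (1 - 1 / b)) = m / (b - 1)"
    using assms by (simp add: field_simps)
  moreover have "(\<lambda>n. (m / b) * (1 / b) ^ n) = (\<lambda>n. m / b ^ Suc n)"
    by (simp add: power_one_over)
  ultimately show ?thesis by (simp only:)
qed

lemma summable_radix:
  fixes b m :: real
  assumes "b > 1" "\<forall>n. c n \<in> {0..m}"
  shows "summable (\<lambda>n. c n / b ^ Suc n)"
proof (rule summable_comparison_test')
  show "summable (\<lambda>n. m / b ^ Suc n)"
    using sums_geometric_Suc[OF assms(1)] by (auto simp: sums_iff)
  show "norm (c n / b ^ Suc n) \<le> m / b ^ Suc n" for n
  proof -
    have "0 \<le> c n" "c n \<le> m" using assms(2) by auto
    then show ?thesis using assms(1) by (simp add: divide_right_mono)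
  qed
qed

lemma radix_bounds:
  assumes "b > 1" "\<forall>n. c n \<in> {0..m}"
  shows "radix b c \<in> {0..m / (b - 1)}"
proof -
  have c: "0 \<le> c n" "c n \<le> m" for n using assms(2) by auto
  have "radix b c \<le> (\<Sum>n. m / b ^ Suc n)"
    unfolding radix_def using assms sums_geometric_Suc[OF assms(1), of m] c
    by (intro suminf_le summable_radix[OF assms]) (auto simp: sums_iff divide_right_mono)
  moreover have "radix b c \<ge> 0"
    unfolding radix_def using assms c by (intro suminf_nonneg summable_radix[OF assms]) auto
  ultimately show ?thesis
    using sums_geometric_Suc[OF assms(1), of m] by (auto simp: sums_iff)
qed

lemma radix_shift:
  assumes "b > 1" "\<forall>n. c n \<in> {0..m}"
  shows "radix b c = (c 0 + radix b (\<lambda>n. c (Suc n))) / b"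
proof -
  have s: "summable (\<lambda>n. c (Suc n) / b ^ Suc n)"
    using assms by (intro summable_radix[of b "\<lambda>n. c (Suc n)" m]) auto
  have "radix b c = (\<Sum>n. c (Suc n) / b ^ Suc (Suc n)) + c 0 / b"
    unfolding radix_def using suminf_split_head[OF summable_radix[OF assms]] by simp
  also have "(\<Sum>n. c (Suc n) / b ^ Suc (Suc n)) = (\<Sum>n. c (Suc n) / b ^ Suc n / b)"
    by (intro suminf_cong) (simp add: field_simps)
  also have "\<dots> = radix b (\<lambda>n. c (Suc n)) / b"
    unfolding radix_def by (rule suminf_divide[OF s])
  finally show ?thesis by (simp add: add_divide_distrib)
qed

lemma digit_set_bounds:
  assumes "b > 1" "D \<subseteq> {0..m}"
  shows "digit_set b D \<subseteq> {0..m / (b - 1)}"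
  using radix_bounds[OF assms(1), of _ m] assms(2) unfolding digit_set_def by blast

lemma digit_set_step:
  assumes "b > 1" "D \<subseteq> {0..m}" "x \<in> digit_set b D"
  shows "\<exists>d\<in>D. b * x - d \<in> digit_set b D"
proof -
  obtain c where c: "\<forall>n. c n \<in> D" "x = radix b c"
    using assms(3) by (auto simp: digit_set_def)
  have "b * x - c 0 = radix b (\<lambda>n. c (Suc n))"
    using radix_shift[OF assms(1), of c m] c assms(1,2) by (auto simp: subset_iff)
  moreover have "c 0 \<in> D" "\<forall>n. c (Suc n) \<in> D" using c(1) by auto
  ultimately show ?thesis unfolding digit_set_def by blast
qed

text \<open>
  To show that every element of a bounded set has an expansion, it suffices to extract a first
  digit without leaving the set. Boundedness makes the remainders \<open>(f ^^ n) x / b ^ n\<close> vanish.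
\<close>

lemma digit_set_coinduct:
  assumes b: "b > 1" and K: "bounded K"
    and step: "\<And>x. x \<in> K \<Longrightarrow> \<exists>d\<in>D. b * x - d \<in> K"
  shows "K \<subseteq> digit_set b D"
proof
  fix x assume "x \<in> K"
  obtain \<delta> where \<delta>: "\<And>x. x \<in> K \<Longrightarrow> \<delta> x \<in> D" "\<And>x. x \<in> K \<Longrightarrow> b * x - \<delta> x \<in> K"
    using step by metis
  define f where "f = (\<lambda>x. b * x - \<delta> x)"
  define c where "c = (\<lambda>n. \<delta> ((f ^^ n) x))"
  have inK: "(f ^^ n) x \<in> K" for n
    by (induction n) (use \<open>x \<in> K\<close> \<delta> in \<open>auto simp: f_def\<close>)
  have partial: "(\<Sum>i<n. c i / b ^ Suc i) = x - (f ^^ n) x / b ^ n" for n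
  proof (induction n)
    case (Suc n)
    have "(f ^^ Suc n) x = b * (f ^^ n) x - c n" by (simp add: f_def c_def)
    then have "(f ^^ Suc n) x / b ^ Suc n = (f ^^ n) x / b ^ n - c n / b ^ Suc n"
      using b by (simp add: diff_divide_distrib)
    then show ?case using Suc by simp
  qed simp
  obtain B where B: "\<And>y. y \<in> K \<Longrightarrow> \<bar>y\<bar> \<le> B"
    using K by (auto simp: bounded_iff)
  have lim: "(\<lambda>n. (f ^^ n) x / b ^ n) \<longlonglongrightarrow> 0"
  proof (rule Lim_null_comparison)
    show "\<forall>\<^sub>F n in sequentially. norm ((f ^^ n) x / b ^ n) \<le> B * (1 / b) ^ n"
      using B[OF inK] b by (intro always_eventually)
        (auto simp: power_one_over abs_divide divide_right_mono)
    show "(\<lambda>n. B * (1 / b) ^ n) \<longlonglongrightarrow> 0"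
      using b by (intro tendsto_mult_right_zero LIMSEQ_power_zero) auto
  qed
  have "(\<lambda>n. c n / b ^ Suc n) sums x"
    unfolding sums_def partial using tendsto_diff[OF tendsto_const lim, of x] by simp
  then have "x = radix b c" by (simp add: radix_def sums_iff)
  moreover have "\<forall>n. c n \<in> D" using \<delta>(1) inK by (auto simp: c_def)
  ultimately show "x \<in> digit_set b D" by (auto simp: digit_set_def)
qed

lemma digit_set_cons:
  assumes "b > 1" "D \<subseteq> {0..m}" "d \<in> D" "y \<in> digit_set b D"
  shows "(d + y) / b \<in> digit_set b D"
proof -
  let ?K = "insert ((d + y) / b) (digit_set b D)"
  have "bounded ?K"
    using bounded_subset[OF bounded_closed_interval digit_set_bounds[OF assms(1,2)]] by simp
  moreover have "\<exists>e\<in>D. b * x - e \<in> ?K" if "x \<in> ?K" for x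
    using that
  proof
    assume "x = (d + y) / b"
    then have "b * x - d = y" using assms(1) by simp
    then show ?thesis using assms by auto
  qed (use digit_set_step[OF assms(1,2)] in blast)
  ultimately show ?thesis
    using digit_set_coinduct[OF assms(1), of ?K D] by blast
qed

text \<open>
  The closure inherits the digit extraction property, so it is contained in the set itself.
\<close>

lemma closed_digit_set:
  assumes "b > 1" "D \<subseteq> {0..m}" "finite D"
  shows "closed (digit_set b D)"
proof -
  let ?S = "digit_set b D"
  have "bounded ?S"
    using bounded_subset[OF bounded_closed_interval digit_set_bounds[OF assms(1,2)]] .
  then have "bounded (closure ?S)" by (rule bounded_closure)
  moreover have "\<exists>d\<in>D. b * x - d \<in> closure ?S" if "x \<in> closure ?S" for x
  proof -
    let ?U = "\<Union>d\<in>D. (\<lambda>x. b * x - d) -` closure ?S"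
    have "closed ?U"
      using assms(3) by (intro closed_UN ballI closed_vimage continuous_intros) auto
    moreover have "?S \<subseteq> ?U"
      using digit_set_step[OF assms(1,2)] closure_subset[of ?S] by fastforce
    ultimately have "closure ?S \<subseteq> ?U" by (rule closure_minimal[rotated])
    then show ?thesis using that by auto
  qed
  ultimately have "closure ?S \<subseteq> ?S" by (rule digit_set_coinduct[OF assms(1)])
  then show ?thesis by (simp add: closure_subset_eq)
qed

section \<open>The tile and its boundary\<close>

text \<open>
  The Cantor set \<open>C\<close> of the introduction, consisting of three disjoint copies of itself scaled by
  \<open>1/4\<close>.
\<close>

definition C_set :: "real set" where
  "C_set = digit_set 4 {0, 1, 2}"

lemma C_bounds: "x \<in> C_set \<Longrightarrow> 0 \<le> x \<and> x \<le> 2 / 3"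
  using digit_set_bounds[of 4 "{0, 1, 2}" 2] by (auto simp: C_set_def)

lemma C_step: "x \<in> C_set \<Longrightarrow> \<exists>d\<in>{0, 1, 2}. 4 * x - d \<in> C_set"
  unfolding C_set_def by (rule digit_set_step[of _ _ 2]) auto

lemma X_set_eq: "X_set = digit_set 4 {0, 2, 3, 5}"
proof -
  have "\<exists>\<alpha>. radix 4 c = (\<Sum>n. \<alpha> (Suc n) / 4 ^ Suc n) \<and> (\<forall>n\<ge>1. \<alpha> n \<in> {0, 2, 3, 5})"
    if "\<forall>n. c n \<in> {0, 2, 3, 5}" for c :: "nat \<Rightarrow> real"
    using that by (intro exI[of _ "\<lambda>n. c (n - 1)"]) (auto simp: radix_def)
  moreover have "(\<Sum>n. \<alpha> (Suc n) / 4 ^ Suc n) \<in> digit_set 4 {0, 2, 3, 5}"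
    if "\<forall>n\<ge>1. \<alpha> n \<in> {0, 2, 3, 5}" for \<alpha> :: "nat \<Rightarrow> real"
    unfolding digit_set_def radix_def
    using that by (intro image_eqI[of _ _ "\<lambda>n. \<alpha> (Suc n)"]) auto
  ultimately show ?thesis
    unfolding X_set_def by (fastforce simp: digit_set_def)
qed

lemma X_bounds: "x \<in> X_set \<Longrightarrow> 0 \<le> x \<and> x \<le> 5 / 3"
  using digit_set_bounds[of 4 "{0, 2, 3, 5}" 5] by (auto simp: X_set_eq)

lemma X_step: "x \<in> X_set \<Longrightarrow> \<exists>d\<in>{0, 2, 3, 5}. 4 * x - d \<in> X_set"
  unfolding X_set_eq by (rule digit_set_step[of _ _ 5]) auto

lemma X_cons: "d \<in> {0, 2, 3, 5} \<Longrightarrow> y \<in> X_set \<Longrightarrow> (d + y) / 4 \<in> X_set"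
  unfolding X_set_eq by (rule digit_set_cons[of _ _ 5]) auto

lemma closed_X: "closed X_set"
  unfolding X_set_eq by (rule closed_digit_set[of _ _ 5]) auto

text \<open>
  The union of \<open>C\<close> and \<open>C + 1\<close> is stable under extraction of digits from \<open>{0, 2, 3, 5}\<close>.
\<close>

lemma C_subset_X: "x \<in> C_set \<Longrightarrow> x \<in> X_set \<and> x + 1 \<in> X_set"
proof -
  let ?K = "C_set \<union> (\<lambda>x. x + 1) ` C_set"
  have "?K \<subseteq> {0..5 / 3}" using C_bounds by force
  then have "bounded ?K" by (rule bounded_subset[OF bounded_closed_interval])
  moreover have "\<exists>d\<in>{0, 2, 3, 5}. 4 * x - d \<in> ?K" if "x \<in> ?K" for x
    using that
  proof
    assume "x \<in> C_set"
    then consider "4 * x - 0 \<in> C_set" | "4 * x - 1 \<in> C_set" | "4 * x - 2 \<in> C_set"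
      using C_step by blast
    then show ?thesis
    proof cases
      case 2
      then have "4 * x - 0 \<in> ?K" by (auto intro: image_eqI[of _ _ "4 * x - 1"])
      then show ?thesis by blast
    qed blast+
  next
    assume "x \<in> (\<lambda>x. x + 1) ` C_set"
    then obtain y where y: "y \<in> C_set" "x = y + 1" by blast
    then consider "4 * y - 0 \<in> C_set" | "4 * y - 1 \<in> C_set" | "4 * y - 2 \<in> C_set"
      using C_step by blast
    then show ?thesis
    proof cases
      case 1
      then have "4 * x - 3 \<in> ?K" using y by (auto intro: image_eqI[of _ _ "4 * y"])
      then show ?thesis by blast
    next
      case 2
      then have "4 * x - 5 \<in> ?K" using y by auto
      then show ?thesis by blast
    next
      case 3
      then have "4 * x - 5 \<in> ?K" using y by (auto intro: image_eqI[of _ _ "4 * y - 2"])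
      then show ?thesis by blast
    qed
  qed
  ultimately have "?K \<subseteq> X_set"
    unfolding X_set_eq by (intro digit_set_coinduct) auto
  then show "x \<in> C_set \<Longrightarrow> x \<in> X_set \<and> x + 1 \<in> X_set" by auto
qed

text \<open>
  If \<open>d\<close> and \<open>e\<close> are first digits of \<open>x\<close> and \<open>x + 1\<close>, the remainders differ by the integer
  \<open>4 + d - e\<close>, which has absolute value at most 1 since both lie in \<open>[0, 5/3]\<close>. Only the pairs
  \<open>(0, 3)\<close>, \<open>(0, 5)\<close> and \<open>(2, 5)\<close> are possible, and they correspond to the digits 0, 1 and 2.
\<close>

lemma X_Int_translate_subset_C:
  assumes "x \<in> X_set" "x + 1 \<in> X_set"
  shows "x \<in> C_set"
proof -
  let ?K = "{x \<in> X_set. x + 1 \<in> X_set}"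
  have "?K \<subseteq> {0..5 / 3}" using X_bounds by force
  then have "bounded ?K" by (rule bounded_subset[OF bounded_closed_interval])
  moreover have "\<exists>d\<in>{0, 1, 2}. 4 * x - d \<in> ?K" if "x \<in> ?K" for x
  proof -
    have x: "x \<in> X_set" "x + 1 \<in> X_set" using that by auto
    obtain d where d: "d \<in> {0, 2, 3, 5}" "4 * x - d \<in> X_set"
      using X_step[OF x(1)] by metis
    obtain e where e: "e \<in> {0, 2, 3, 5}" "4 * (x + 1) - e \<in> X_set"
      using X_step[OF x(2)] by metis
    have "- (5 / 3) \<le> 4 + d - e" "4 + d - e \<le> 5 / 3"
      using X_bounds[OF d(2)] X_bounds[OF e(2)] by (simp_all only: ring_distribs) linarith+
    then consider "d = 0" "e = 3" | "d = 0" "e = 5" | "d = 2" "e = 5"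
      using d(1) e(1) by auto
    then show ?thesis
    proof cases
      case 1
      then have "4 * x - 0 \<in> ?K" using d e by (auto simp: algebra_simps)
      then show ?thesis by blast
    next
      case 2
      then have "4 * x - 1 \<in> ?K" using d e by (auto simp: algebra_simps)
      then show ?thesis by blast
    next
      case 3
      then have "4 * x - 2 \<in> ?K" using d e by (auto simp: algebra_simps)
      then show ?thesis by blast
    qed
  qed
  ultimately have "?K \<subseteq> C_set"
    unfolding C_set_def by (intro digit_set_coinduct) auto
  then show ?thesis using assms by blast
qed

lemma zero_in_X: "0 \<in> X_set"
  using digit_set_coinduct[of 4 "{0}" "{0, 2, 3, 5}"] by (simp add: X_set_eq)

text \<open>
  Passing from \<open>n\<close> to \<open>n + 1\<close> divides a point of \<open>k + X\<close> by 4. Writing \<open>k = 4 * q + d\<close> with a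
  digit \<open>d\<close> shows that the quotient lies in \<open>q + X\<close>.
\<close>

lemma X_translates_4adic: "\<exists>k::int. of_int m / 4 ^ n - of_int k \<in> X_set"
proof (induction n)
  case 0
  show ?case using zero_in_X by (intro exI[of _ m]) simp
next
  case (Suc n)
  then obtain k :: int where k: "of_int m / 4 ^ n - of_int k \<in> X_set" by blast
  obtain q d :: int where q: "k = 4 * q + d" "d \<in> {0, 2, 3, 5}"
  proof -
    have "k mod 4 \<in> {0, 1, 2, 3}" by auto
    then consider "k mod 4 \<in> {0, 2, 3}" | "k mod 4 = 1" by blast
    then show thesis
    proof cases
      case 1
      then show thesis using that[of "k div 4" "k mod 4"] by auto
    next
      case 2
      \<comment> \<open>the digit 5 represents the residue class of 1\<close>
      then show thesis using that[of "k div 4 - 1" 5] mult_div_mod_eq[of 4 k] by auto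
    qed
  qed
  have "(of_int d + (of_int m / 4 ^ n - of_int k)) / 4 \<in> X_set"
    using k q(2) by (intro X_cons) auto
  also have "(of_int d + (of_int m / 4 ^ n - of_int k)) / 4 = of_int m / 4 ^ Suc n - real_of_int q"
    using q(1) by (simp add: field_simps)
  finally show ?case by blast
qed

text \<open>
  The numbers \<open>m / 4 ^ n\<close> are dense, and locally only finitely many of the closed translates
  of \<open>X\<close> matter, so that a limit of covered points is covered.
\<close>

lemma X_translates_cover: "\<exists>k::int. x - of_int k \<in> X_set"
proof -
  define W where "W = (\<Union>k\<in>{\<lfloor>x\<rfloor> - 3..\<lfloor>x\<rfloor> + 1}. (\<lambda>y. y - of_int k) -` X_set)"
  define q where "q = (\<lambda>n. of_int \<lfloor>4 ^ n * x\<rfloor> / 4 ^ n :: real)"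
  have q: "x - 1 / 4 ^ n \<le> q n" "q n \<le> x" for n
  proof -
    have "(4 ^ n * x - 1) / 4 ^ n \<le> q n" "q n \<le> (4 ^ n * x) / 4 ^ n"
      unfolding q_def by (intro divide_right_mono; linarith?; simp)+
    then show "x - 1 / 4 ^ n \<le> q n" "q n \<le> x" by (simp_all add: diff_divide_distrib)
  qed
  have "closed W"
    unfolding W_def by (intro closed_UN ballI closed_vimage closed_X continuous_intros) auto
  moreover have "q n \<in> W" for n
  proof -
    obtain k :: int where k: "q n - of_int k \<in> X_set"
      using X_translates_4adic unfolding q_def by blast
    have "1 / 4 ^ n \<le> (1::real)" by simp
    then have "x - 1 \<le> q n" using q(1)[of n] by linarith
    with X_bounds[OF k] q(2)[of n] have "\<lfloor>x\<rfloor> - 3 \<le> k" "k \<le> \<lfloor>x\<rfloor> + 1"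
      by linarith+
    then show ?thesis using k by (auto simp: W_def)
  qed
  moreover have "q \<longlonglongrightarrow> x"
  proof (rule tendsto_sandwich)
    have "(\<lambda>n. (1 / 4) ^ n) \<longlonglongrightarrow> (0::real)" by (rule LIMSEQ_power_zero) simp
    from tendsto_diff[OF tendsto_const this, of x]
    show "(\<lambda>n. x - 1 / 4 ^ n) \<longlonglongrightarrow> x" by (simp add: power_one_over)
  qed (use q in auto)
  ultimately have "x \<in> W" by (metis closed_sequentially)
  then show ?thesis by (auto simp: W_def)
qed

lemma X_C_subset: "X_C \<subseteq> C_set \<union> (\<lambda>x. x + 1) ` C_set"
proof
  fix x assume "x \<in> X_C"
  then have x: "x \<in> X_set" "x \<notin> interior X_set"
    using closed_X by (auto simp: X_C_def frontier_def)
  have "x - 1 \<in> X_set \<or> x + 1 \<in> X_set"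
  proof (rule ccontr)
    assume not: "\<not> (x - 1 \<in> X_set \<or> x + 1 \<in> X_set)"
    let ?V = "ball x (1 / 3) - ((\<lambda>y. y - 1) -` X_set \<union> (\<lambda>y. y + 1) -` X_set)"
    have "open ?V"
      by (intro open_Diff open_ball closed_Un closed_vimage closed_X continuous_intros)
    moreover have "x \<in> ?V" using not by simp
    moreover have "?V \<subseteq> X_set"
    proof
      fix y assume y: "y \<in> ?V"
      obtain k :: int where k: "y - of_int k \<in> X_set" using X_translates_cover by blast
      have "\<bar>x - y\<bar> < 1 / 3" using y by (simp add: dist_real_def)
      with X_bounds[OF k] X_bounds[OF x(1)] have "k < 2" "k > -2"
        by linarith+
      moreover have "y - 1 \<notin> X_set" "y + 1 \<notin> X_set" using y by auto
      then have "k \<noteq> 1" "k \<noteq> - 1" using k by auto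
      ultimately have "k = 0" by linarith
      then show "y \<in> X_set" using k by simp
    qed
    ultimately show False using x(2) by (meson interiorI)
  qed
  then show "x \<in> C_set \<union> (\<lambda>x. x + 1) ` C_set"
  proof
    assume "x - 1 \<in> X_set"
    then have "x - 1 \<in> C_set" using x(1) X_Int_translate_subset_C[of "x - 1"] by simp
    then have "(x - 1) + 1 \<in> (\<lambda>x. x + 1) ` C_set" by (rule imageI)
    then show ?thesis by simp
  next
    assume "x + 1 \<in> X_set"
    then show ?thesis using x(1) X_Int_translate_subset_C[of x] by simp
  qed
qed

text \<open>
  On this interval the only integer translate of \<open>[0, 5/3]\<close> that can contribute to the cover is
  the one by 0.
\<close>

lemma open_interval_subset_X: "{2 / 3<..<1} \<subseteq> X_set"
proof
  fix x :: real assume x: "x \<in> {2 / 3<..<1}"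
  obtain k :: int where k: "x - of_int k \<in> X_set" using X_translates_cover by blast
  with X_bounds[OF k] x have "k < 1" "k > -1" by auto
  then have "k = 0" by linarith
  with k show "x \<in> X_set" by simp
qed

text \<open>
  Every point of \<open>X\<close> lies in a copy of \<open>X\<close> scaled by \<open>1 / 4 ^ n\<close> that is contained in \<open>X\<close>;
  the offset \<open>a\<close> is given by the first \<open>n\<close> digits.
\<close>

lemma X_cylinder:
  assumes "y \<in> X_set"
  shows "\<exists>a. (\<exists>z\<in>X_set. y = a + z / 4 ^ n) \<and> (\<forall>z\<in>X_set. a + z / 4 ^ n \<in> X_set)"
  using assms
proof (induction n arbitrary: y)
  case 0
  then show ?case by (intro exI[of _ 0]) auto
next
  case (Suc n)
  obtain d where d: "d \<in> {0, 2, 3, 5}" "4 * y - d \<in> X_set"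
    using X_step[OF Suc.prems] by blast
  obtain a z where a: "z \<in> X_set" "4 * y - d = a + z / 4 ^ n"
      "\<forall>z\<in>X_set. a + z / 4 ^ n \<in> X_set"
    using Suc.IH[OF d(2)] by blast
  have "y = (d + a) / 4 + z / 4 ^ Suc n"
    using a(2) by (simp add: field_simps)
  moreover have "(d + a) / 4 + w / 4 ^ Suc n \<in> X_set" if "w \<in> X_set" for w
  proof -
    have "(d + (a + w / 4 ^ n)) / 4 \<in> X_set"
      using a(3) that by (intro X_cons d) auto
    moreover have "(d + (a + w / 4 ^ n)) / 4 = (d + a) / 4 + w / 4 ^ Suc n"
      by (simp add: add_divide_distrib)
    ultimately show ?thesis by simp
  qed
  ultimately show ?case using a(1) by blast
qed

lemma X_subset_closure_interior: "X_set \<subseteq> closure (interior X_set)"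
proof
  fix y assume y: "y \<in> X_set"
  show "y \<in> closure (interior X_set)"
    unfolding closure_approachable
  proof (intro allI impI)
    fix e :: real assume "e > 0"
    have "(\<lambda>n. 2 * (1 / 4) ^ n) \<longlonglongrightarrow> (0::real)"
      by (intro tendsto_mult_right_zero LIMSEQ_power_zero) simp
    then have "\<forall>\<^sub>F n in sequentially. 2 * (1 / 4) ^ n < e"
      using \<open>e > 0\<close> by (rule order_tendstoD)
    then obtain n where n: "2 * (1 / 4) ^ n < e"
      by (auto simp: eventually_sequentially)
    obtain a z where a: "z \<in> X_set" "y = a + z / 4 ^ n"
        "\<forall>z\<in>X_set. a + z / 4 ^ n \<in> X_set"
      using X_cylinder[OF y] by blast
    let ?V = "(\<lambda>x. 4 ^ n * (x - a)) -` {2 / 3<..<1}"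
    have "open ?V" by (intro open_vimage open_greaterThanLessThan continuous_intros)
    moreover have "?V \<subseteq> X_set"
    proof
      fix x assume "x \<in> ?V"
      then have "4 ^ n * (x - a) \<in> X_set" using open_interval_subset_X by auto
      with a(3) have "a + 4 ^ n * (x - a) / 4 ^ n \<in> X_set" by blast
      then show "x \<in> X_set" by simp
    qed
    \<comment> \<open>5/6 is the midpoint of the interval from 2/3 to 1\<close>
    moreover have "a + (5 / 6) / 4 ^ n \<in> ?V" by simp
    ultimately have "a + (5 / 6) / 4 ^ n \<in> interior X_set"
      by (meson interior_maximal subsetD)
    moreover have "dist (a + (5 / 6) / 4 ^ n) y < e"
    proof -
      have "(a + (5 / 6) / 4 ^ n) - y = (5 / 6 - z) / 4 ^ n"
        unfolding a(2) diff_divide_distrib by simp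
      then have "dist (a + (5 / 6) / 4 ^ n) y = \<bar>5 / 6 - z\<bar> / 4 ^ n"
        by (simp only: dist_real_def abs_divide) simp
      also have "\<dots> \<le> 2 / 4 ^ n"
        using X_bounds[OF a(1)] by (intro divide_right_mono) auto
      finally show ?thesis using n by (simp add: power_one_over)
    qed
    ultimately show "\<exists>x\<in>interior X_set. dist x y < e" by blast
  qed
qed

lemma C_power_step: "x \<in> C_set \<Longrightarrow> \<exists>m::int. 4 ^ n * x - of_int m \<in> C_set"
proof (induction n)
  case 0
  then show ?case by (intro exI[of _ 0]) simp
next
  case (Suc n)
  then obtain m :: int where "4 ^ n * x - of_int m \<in> C_set" by blast
  from C_step[OF this] obtain d where d: "d \<in> {0, 1, 2}" "4 * (4 ^ n * x - of_int m) - d \<in> C_set"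
    by blast
  from d(1) obtain e :: int where "d = of_int e"
    by (elim insertE) (auto intro: that[of 0] that[of 1] that[of 2])
  with d(2) show ?case by (intro exI[of _ "4 * m + e"]) (simp add: algebra_simps)
qed

text \<open>
  For \<open>x \<in> C\<close> the fractional part of \<open>4 ^ n * x\<close> is at most \<open>2/3\<close>. Every open interval
  contains, for large \<open>n\<close>, points for which it is \<open>5/6\<close>.
\<close>

lemma interior_C: "interior C_set = {}"
proof (rule ccontr)
  assume "interior C_set \<noteq> {}"
  then obtain x e where e: "e > 0" "ball x e \<subseteq> C_set"
    by (meson ex_in_conv mem_interior)
  obtain n where n: "1 / e < 4 ^ n" using real_arch_pow[of 4 "1 / e"] by auto
  define y where "y = (of_int \<lfloor>4 ^ n * x\<rfloor> + 5 / 6) / (4::real) ^ n"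
  have "\<bar>4 ^ n * y - 4 ^ n * x\<bar> < 1"
    unfolding y_def by simp linarith
  also have "1 < 4 ^ n * e" using n e by (simp add: field_simps)
  finally have "4 ^ n * \<bar>y - x\<bar> < 4 ^ n * e"
    by (simp add: abs_mult flip: right_diff_distrib)
  then have "y \<in> C_set" using e(2) by (auto simp: dist_real_def abs_minus_commute)
  then obtain m :: int where "4 ^ n * y - of_int m \<in> C_set" using C_power_step by blast
  moreover have "4 ^ n * y - of_int m = of_int (\<lfloor>4 ^ n * x\<rfloor> - m) + 5 / 6"
    by (simp add: y_def)
  ultimately have "0 \<le> of_int (\<lfloor>4 ^ n * x\<rfloor> - m) + (5 / 6 :: real)"
    "of_int (\<lfloor>4 ^ n * x\<rfloor> - m) + 5 / 6 \<le> (2 / 3 :: real)"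
    using C_bounds by metis+
  then have "\<lfloor>4 ^ n * x\<rfloor> - m > - 1" "\<lfloor>4 ^ n * x\<rfloor> - m < 0"
    by linarith+
  then show False by linarith
qed

lemma C_subset_X_C: "C_set \<subseteq> X_C"
proof
  fix x assume x: "x \<in> C_set"
  have "x \<notin> interior X_set"
  proof
    assume xi: "x \<in> interior X_set"
    let ?V = "(\<lambda>y. y - 1) -` interior X_set"
    have "open ?V" by (intro open_vimage continuous_intros) auto
    moreover have "x + 1 \<in> ?V" using xi by simp
    moreover have "x + 1 \<in> closure (interior X_set)"
      using C_subset_X[OF x] X_subset_closure_interior by blast
    ultimately obtain y where y: "y \<in> ?V" "y \<in> interior X_set"
      using open_Int_closure_eq_empty[of ?V "interior X_set"] by blast
    have "?V \<inter> interior X_set \<subseteq> (\<lambda>y. y - 1) -` C_set"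
      using X_Int_translate_subset_C interior_subset[of X_set] by fastforce
    then have "(\<lambda>y. y + 1) -` (?V \<inter> interior X_set) \<subseteq> C_set" by auto
    moreover have "open ((\<lambda>y. y + 1) -` (?V \<inter> interior X_set))"
      by (intro open_vimage open_Int continuous_intros) auto
    ultimately have "(\<lambda>y. y + 1) -` (?V \<inter> interior X_set) \<subseteq> {}"
      using interior_maximal interior_C by metis
    moreover have "y - 1 \<in> (\<lambda>y. y + 1) -` (?V \<inter> interior X_set)" using y by simp
    ultimately show False by blast
  qed
  then show "x \<in> X_C"
    using C_subset_X[OF x] closed_X by (auto simp: X_C_def frontier_def)
qed

section \<open>The Hausdorff dimension of the boundary\<close>

lemma hausdorff_premeasure_le_card:
  fixes E :: "'a::metric_space set"
  assumes "finite F" "E \<subseteq> \<Union>F"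
    and F: "\<And>U. U \<in> F \<Longrightarrow> bounded U \<and> diameter U \<le> \<delta>"
    and "s > 0" "\<delta> > 0"
  shows "hausdorff_premeasure s \<delta> E \<le> ennreal (real (card F) * \<delta> powr s)"
proof -
  obtain g where g: "bij_betw g {0..<card F} F"
    using ex_bij_betw_nat_finite[OF assms(1)] by blast
  define U where "U = (\<lambda>i. if i < card F then g i else {})"
  have gF: "g i \<in> F" if "i < card F" for i using g that by (auto simp: bij_betw_def)
  have "E \<subseteq> (\<Union>i. U i)"
  proof
    fix x assume "x \<in> E"
    then obtain V where "V \<in> F" "x \<in> V" using assms(2) by blast
    moreover obtain i where "i < card F" "g i = V"
      using g \<open>V \<in> F\<close> unfolding bij_betw_def by (metis atLeastLessThan_iff imageE)
    ultimately show "x \<in> (\<Union>i. U i)" by (auto simp: U_def intro!: exI[of _ i])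
  qed
  moreover have U: "bounded (U i) \<and> diameter (U i) \<le> \<delta>" for i
    using F[OF gF] assms(5) by (auto simp: U_def)
  ultimately have "hausdorff_premeasure s \<delta> E \<le> (\<Sum>i. diam_pow s (U i))"
    unfolding hausdorff_premeasure_def by (intro INF_lower) auto
  also have "\<dots> = (\<Sum>i<card F. diam_pow s (U i))"
    by (rule suminf_finite) (auto simp: U_def diam_pow_def)
  also have "\<dots> \<le> (\<Sum>i<card F. ennreal (\<delta> powr s))"
  proof (rule sum_mono)
    fix i
    show "diam_pow s (U i) \<le> ennreal (\<delta> powr s)"
      using U[of i] assms(4) diameter_ge_0[of "U i"]
      by (auto simp: diam_pow_def intro!: ennreal_leI powr_mono2)
  qed
  also have "\<dots> = ennreal (real (card F) * \<delta> powr s)"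
    by (simp add: ennreal_mult ennreal_of_nat_eq_real_of_nat)
  finally show ?thesis .
qed

lemma hausdorff_premeasure_antimono:
  assumes "\<delta> \<le> \<delta>'"
  shows "hausdorff_premeasure s \<delta>' E \<le> hausdorff_premeasure s \<delta> E"
  unfolding hausdorff_premeasure_def
  using assms by (intro INF_superset_mono) (auto intro: order_trans)

lemma C_cover:
  "\<exists>A. finite A \<and> card A \<le> 3 ^ n \<and> C_set \<subseteq> (\<Union>a\<in>A. {a..a + 1 / 4 ^ n})"
proof (induction n)
  case 0
  show ?case using C_bounds by (intro exI[of _ "{0}"]) force
next
  case (Suc n)
  then obtain A where A: "finite A" "card A \<le> 3 ^ n" "C_set \<subseteq> (\<Union>a\<in>A. {a..a + 1 / 4 ^ n})"
    by blast
  let ?B = "(\<lambda>(d, a). (d + a) / 4) ` ({0, 1, 2} \<times> A)"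
  have "card ?B \<le> card ({0, 1, 2 :: real} \<times> A)" using A by (intro card_image_le) auto
  also have "\<dots> \<le> 3 ^ Suc n" using A by (simp add: card_cartesian_product)
  finally have "card ?B \<le> 3 ^ Suc n" .
  moreover have "C_set \<subseteq> (\<Union>b\<in>?B. {b..b + 1 / 4 ^ Suc n})"
  proof
    fix x assume "x \<in> C_set"
    from C_step[OF this] obtain d where d: "d \<in> {0, 1, 2}" "4 * x - d \<in> C_set" by blast
    then obtain a where a: "a \<in> A" "4 * x - d \<in> {a..a + 1 / 4 ^ n}" using A by blast
    have "x \<in> {(d + a) / 4..(d + a) / 4 + 1 / 4 ^ Suc n}"
      using a(2) by (auto simp: field_simps)
    moreover have "(d + a) / 4 \<in> ?B" using d a by (intro image_eqI[of _ _ "(d, a)"]) auto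
    ultimately show "x \<in> (\<Union>b\<in>?B. {b..b + 1 / 4 ^ Suc n})" by blast
  qed
  ultimately show ?case using A(1) by (intro exI[of _ ?B]) blast
qed

lemma log_4_3: "0 < log 4 (3::real)" "log 4 (3::real) < 1" "4 powr (log 4 3) = (3::real)"
  by auto

lemma hausdorff_premeasure_X_C_le:
  assumes "s > 0"
  shows "hausdorff_premeasure s (1 / 4 ^ n) X_C \<le> ennreal (2 * (3 / 4 powr s) ^ n)"
proof -
  obtain A where A: "finite A" "card A \<le> 3 ^ n" "C_set \<subseteq> (\<Union>a\<in>A. {a..a + 1 / 4 ^ n})"
    using C_cover by blast
  let ?B = "A \<union> (\<lambda>a. a + 1) ` A"
  let ?F = "(\<lambda>a. {a..a + 1 / 4 ^ n}) ` ?B"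
  have "card ?F \<le> card ?B" using A by (intro card_image_le) auto
  also have "\<dots> \<le> card A + card ((\<lambda>a. a + 1) ` A)" by (rule card_Un_le)
  also have "\<dots> \<le> 2 * 3 ^ n" using A card_image_le[OF A(1), of "\<lambda>a. a + 1"] by simp
  finally have "card ?F \<le> 2 * 3 ^ n" .
  then have card: "real (card ?F) \<le> 2 * 3 ^ n" using of_nat_mono[of "card ?F" "2 * 3 ^ n"] by simp
  have "X_C \<subseteq> \<Union>?F"
  proof
    fix x assume "x \<in> X_C"
    then consider "x \<in> C_set" | "x - 1 \<in> C_set" using X_C_subset by fastforce
    then show "x \<in> \<Union>?F"
    proof cases
      case 1
      then show ?thesis using A by blast
    next
      case 2
      then obtain a where "a \<in> A" "x - 1 \<in> {a..a + 1 / 4 ^ n}" using A by blast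
      then have "a + 1 \<in> ?B" "x \<in> {a + 1..a + 1 + 1 / 4 ^ n}" by auto
      then show ?thesis by blast
    qed
  qed
  moreover have "bounded U \<and> diameter U \<le> 1 / 4 ^ n" if "U \<in> ?F" for U
    using that by auto
  ultimately have "hausdorff_premeasure s (1 / 4 ^ n) X_C \<le>
      ennreal (real (card ?F) * (1 / 4 ^ n) powr s)"
    using A(1) assms by (intro hausdorff_premeasure_le_card) auto
  also have "\<dots> \<le> ennreal (2 * 3 ^ n * (1 / 4 ^ n) powr s)"
    using card by (intro ennreal_leI mult_right_mono) auto
  also have "(1 / 4 ^ n) powr s = 1 / (4 powr s) ^ n"
    by (simp add: powr_divide powr_powr mult.commute flip: powr_realpow)
  also have "2 * 3 ^ n * (1 / (4 powr s) ^ n) = 2 * (3 / 4 powr s) ^ n"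
    by (simp add: power_divide)
  finally show ?thesis .
qed

lemma hausdorff_measure_X_C_eq_0:
  assumes "s > log 4 3"
  shows "hausdorff_measure s X_C = 0"
proof -
  have s: "s > 0" using assms log_4_3 by linarith
  have "4 powr s > 4 powr (log 4 3)" using assms by (intro powr_less_mono) auto
  then have r: "3 / 4 powr s < 1" by simp
  have "hausdorff_premeasure s \<delta> X_C = 0" if \<delta>: "\<delta> > 0" for \<delta>
  proof -
    have "(\<lambda>n. 2 * (3 / 4 powr s) ^ n) \<longlonglongrightarrow> 0"
      using r by (intro tendsto_mult_right_zero LIMSEQ_power_zero) auto
    then have lim: "(\<lambda>n. ennreal (2 * (3 / 4 powr s) ^ n)) \<longlonglongrightarrow> 0"
      using tendsto_ennrealI by fastforce
    have "(\<lambda>n. (1 / 4) ^ n) \<longlonglongrightarrow> (0::real)" by (rule LIMSEQ_power_zero) simp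
    then have "\<forall>\<^sub>F n in sequentially. (1 / 4) ^ n < \<delta>" using \<delta> by (rule order_tendstoD)
    then have "\<forall>\<^sub>F n in sequentially.
        hausdorff_premeasure s \<delta> X_C \<le> ennreal (2 * (3 / 4 powr s) ^ n)"
    proof eventually_elim
      case (elim n)
      then have "1 / 4 ^ n \<le> \<delta>" by (simp add: power_one_over)
      then show ?case
        using hausdorff_premeasure_antimono hausdorff_premeasure_X_C_le[OF s]
        by (meson order_trans)
    qed
    then have "hausdorff_premeasure s \<delta> X_C \<le> 0"
      by (rule tendsto_lowerbound[OF lim]) simp
    then show ?thesis by simp
  qed
  then show ?thesis unfolding hausdorff_measure_def by simp
qed

text \<open>
  Points of \<open>C\<close> with different first digits lie in different pieces of \<open>C\<close>, at distance at
  least \<open>1/4 - 1/6 = 1/12\<close>. As the exponent is less than 1, the constant 12 suffices.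
\<close>

lemma radix_hoelder_first_digit:
  assumes "\<forall>n. c n \<in> {0, 1, 2}" "\<forall>n. c' n \<in> {0, 1, 2}" "c 0 \<noteq> c' 0"
  shows "\<bar>radix 3 c - radix 3 c'\<bar> \<le> 12 * \<bar>radix 4 c - radix 4 c'\<bar> powr log 4 3"
proof -
  let ?s = "\<lambda>c::nat \<Rightarrow> real. \<lambda>n. c (Suc n)"
  have digits: "{0, 1, 2} \<subseteq> {0..2::real}" by auto
  have c: "\<forall>n. c n \<in> {0..2}" "\<forall>n. c' n \<in> {0..2}" "\<forall>n. ?s c n \<in> {0..2}" "\<forall>n. ?s c' n \<in> {0..2}"
    using assms(1,2) digits by blast+
  have "c 0 \<in> {0, 1, 2}" "c' 0 \<in> {0, 1, 2}" using assms by blast+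
  then have "\<bar>c 0 - c' 0\<bar> \<ge> 1" using assms(3) by auto
  moreover have "\<bar>radix 4 (?s c) - radix 4 (?s c')\<bar> \<le> 2 / 3"
    using radix_bounds[OF _ c(3), of 4] radix_bounds[OF _ c(4), of 4]
    by (simp add: abs_if split: if_splits)
  moreover have "radix 4 c - radix 4 c' =
      ((c 0 - c' 0) + (radix 4 (?s c) - radix 4 (?s c'))) / 4"
    using radix_shift[OF _ c(1), of 4] radix_shift[OF _ c(2), of 4] by simp
  ultimately have far: "\<bar>radix 4 c - radix 4 c'\<bar> \<ge> 1 / 12"
    by (simp add: abs_if split: if_splits)
  have "\<bar>radix 3 c - radix 3 c'\<bar> \<le> 1"
    using radix_bounds[OF _ c(1), of 3] radix_bounds[OF _ c(2), of 3] by (simp add: abs_le_iff)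
  also have "1 \<le> 12 * (1 / 12 :: real) powr log 4 3"
    using powr_mono'[of "log 4 3" 1 "1 / 12 :: real"] log_4_3 by simp
  also have "\<dots> \<le> 12 * \<bar>radix 4 c - radix 4 c'\<bar> powr log 4 3"
    using far log_4_3 by (intro mult_left_mono powr_mono2) auto
  finally show ?thesis .
qed

text \<open>
  Equal first digits can be removed: this multiplies the distance by 4 in base 4 and by
  \<open>3 = 4 powr log 4 3\<close> in base 3, so that the inequality is invariant.
\<close>

lemma radix_hoelder:
  assumes "\<forall>n. c n \<in> {0, 1, 2}" "\<forall>n. c' n \<in> {0, 1, 2}"
  shows "\<bar>radix 3 c - radix 3 c'\<bar> \<le> 12 * \<bar>radix 4 c - radix 4 c'\<bar> powr log 4 3"
proof (cases "c = c'")
  case False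
  then obtain n where "c n \<noteq> c' n" by blast
  with assms show ?thesis
  proof (induction n arbitrary: c c')
    case 0
    then show ?case by (intro radix_hoelder_first_digit)
  next
    case (Suc n c c')
    show ?case
    proof (cases "c 0 = c' 0")
      case False
      with Suc.prems show ?thesis by (intro radix_hoelder_first_digit)
    next
      case True
      let ?s = "\<lambda>c::nat \<Rightarrow> real. \<lambda>n. c (Suc n)"
      have "{0, 1, 2} \<subseteq> {0..2::real}" by auto
      then have c: "\<forall>n. c n \<in> {0..2}" "\<forall>n. c' n \<in> {0..2}"
        using Suc.prems(1,2) by blast+
      have shift: "radix b c - radix b c' = (radix b (?s c) - radix b (?s c')) / b"
        if "b > 1" for b
        using radix_shift[OF that c(1)] radix_shift[OF that c(2)] True
        by (simp add: diff_divide_distrib add_divide_distrib)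
      have "\<bar>radix 3 (?s c) - radix 3 (?s c')\<bar>
          \<le> 12 * \<bar>radix 4 (?s c) - radix 4 (?s c')\<bar> powr log 4 3"
        using Suc.prems by (intro Suc.IH) auto
      then have "\<bar>radix 3 c - radix 3 c'\<bar>
          \<le> 12 * (\<bar>radix 4 (?s c) - radix 4 (?s c')\<bar> powr log 4 3 / 4 powr log 4 3)"
        by (simp add: shift abs_divide)
      then show ?thesis by (simp add: shift abs_divide powr_divide)
    qed
  qed
qed simp

lemma unit_interval_subset_ternary: "{0..1} \<subseteq> digit_set 3 {0, 1, 2}"
proof (rule digit_set_coinduct)
  fix x :: real assume "x \<in> {0..1}"
  then have "3 * x - 0 \<in> {0..1} \<or> 3 * x - 1 \<in> {0..1} \<or> 3 * x - 2 \<in> {0..1}" by auto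
  then show "\<exists>d\<in>{0, 1, 2}. 3 * x - d \<in> {0..1}" by blast
qed auto

text \<open>
  The case \<open>s = 0\<close>, where \<open>diam_pow\<close> counts each nonempty set as 1, is included.
\<close>

lemma powr_diameter_le_diam_pow:
  assumes "0 \<le> s" "s \<le> t" "0 < t" "diameter U \<le> 1" "U \<noteq> {}" "bounded U"
  shows "ennreal (diameter U powr t) \<le> diam_pow s U"
proof -
  have "diameter U \<ge> 0" using assms by (intro diameter_ge_0)
  moreover have "diameter U powr t \<le> diameter U powr s" if "s > 0"
    using assms calculation powr_mono'[of s t "diameter U"] by simp
  moreover have "diameter U powr t \<le> 1"
    using assms calculation powr_mono2[of t "diameter U" 1] by simp
  ultimately show ?thesis
    using assms by (auto simp: diam_pow_def intro!: ennreal_leI)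
qed

text \<open>
  The set of base-3 values of the points of \<open>C \<inter> U i\<close> has diameter at most \<open>r i\<close> and so lies in
  the interval \<open>W i\<close> of length \<open>2 * r i\<close>, centred at one of these values. The intervals \<open>W i\<close>
  cover \<open>[0, 1]\<close>; the factor 24 is twice the Hoelder constant.
\<close>

lemma cover_sum_ge:
  assumes s: "0 \<le> s" "s \<le> log 4 3" and cover: "C_set \<subseteq> (\<Union>i::nat. U i)"
    and U: "\<And>i. bounded (U i)" "\<And>i. diameter (U i) \<le> 1"
  shows "1 \<le> 24 * (\<Sum>i. diam_pow s (U i))"
proof -
  define V where "V = (\<lambda>i. {c. (\<forall>n. c n \<in> {0, 1, 2}) \<and> radix 4 c \<in> U i})"
  define r where "r = (\<lambda>i. 12 * diameter (U i) powr log 4 3)"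
  define W where "W = (\<lambda>i. if V i = {} then {} else
    {radix 3 (SOME c. c \<in> V i) - r i..radix 3 (SOME c. c \<in> V i) + r i})"
  have r: "r i \<ge> 0" for i by (simp add: r_def)
  have W_meas: "W i \<in> sets lborel" for i by (simp add: W_def)
  have inW: "radix 3 c \<in> W i" if c: "c \<in> V i" for c i
  proof -
    define c' where "c' = (SOME c. c \<in> V i)"
    have c': "c' \<in> V i" unfolding c'_def by (rule someI[of "\<lambda>c. c \<in> V i", OF c])
    have "dist (radix 4 c) (radix 4 c') \<le> diameter (U i)"
      using c c' by (intro diameter_bounded_bound U) (auto simp: V_def)
    then have "12 * \<bar>radix 4 c - radix 4 c'\<bar> powr log 4 3 \<le> r i"
      unfolding r_def dist_real_def using log_4_3 by (intro mult_left_mono powr_mono2) auto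
    moreover have "\<bar>radix 3 c - radix 3 c'\<bar> \<le> 12 * \<bar>radix 4 c - radix 4 c'\<bar> powr log 4 3"
      using c c' by (intro radix_hoelder) (auto simp: V_def)
    ultimately have "\<bar>radix 3 c - radix 3 c'\<bar> \<le> r i" by linarith
    then show ?thesis using c by (auto simp: W_def c'_def[symmetric] abs_le_iff)
  qed
  have "{0..1} \<subseteq> (\<Union>i. W i)"
  proof
    fix u :: real assume "u \<in> {0..1}"
    then obtain c where c: "\<forall>n. c n \<in> {0, 1, 2}" "u = radix 3 c"
      using unit_interval_subset_ternary by (auto simp: digit_set_def)
    then have "radix 4 c \<in> C_set" by (auto simp: C_set_def digit_set_def)
    then obtain i where "radix 4 c \<in> U i" using cover by blast
    with c inW show "u \<in> (\<Union>i. W i)" by (auto simp: V_def)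
  qed
  then have "emeasure lborel {0..1::real} \<le> emeasure lborel (\<Union>i. W i)"
    using W_meas by (intro emeasure_mono sets.countable_UN) auto
  also have "\<dots> \<le> (\<Sum>i. emeasure lborel (W i))"
    using W_meas by (intro emeasure_subadditive_countably) auto
  also have "\<dots> \<le> (\<Sum>i. 24 * diam_pow s (U i))"
  proof (intro suminf_le summableI)
    fix i
    show "emeasure lborel (W i) \<le> 24 * diam_pow s (U i)"
    proof (cases "V i = {}")
      case False
      then have "U i \<noteq> {}" by (auto simp: V_def)
      have "emeasure lborel (W i) = ennreal (2 * r i)" using False r by (simp add: W_def)
      also have "\<dots> = 24 * ennreal (diameter (U i) powr log 4 3)"
        by (simp add: r_def ennreal_mult')
      also have "\<dots> \<le> 24 * diam_pow s (U i)"
        using s U log_4_3 \<open>U i \<noteq> {}\<close>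
        by (intro mult_left_mono powr_diameter_le_diam_pow) auto
      finally show ?thesis .
    qed (simp add: W_def)
  qed
  finally show ?thesis by simp
qed

lemma hausdorff_measure_pos:
  assumes "0 \<le> s" "s \<le> log 4 3" "C_set \<subseteq> E"
  shows "hausdorff_measure s E \<noteq> 0"
proof
  assume "hausdorff_measure s E = 0"
  moreover have "hausdorff_premeasure s 1 E \<le> hausdorff_measure s E"
    unfolding hausdorff_measure_def by (intro SUP_upper) simp
  ultimately have "hausdorff_premeasure s 1 E < 1 / 24"
    by (simp add: ennreal_zero_less_divide)
  then obtain U where U: "E \<subseteq> (\<Union>i. U i)" "\<And>i. bounded (U i)" "\<And>i. diameter (U i) \<le> 1"
      "(\<Sum>i. diam_pow s (U i)) < 1 / 24"
    unfolding hausdorff_premeasure_def by (auto simp: INF_less_iff)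
  have "1 \<le> 24 * (\<Sum>i. diam_pow s (U i))"
    using assms U by (intro cover_sum_ge) auto
  also have "\<dots> < 24 * (1 / 24)"
    using U(4) by (intro ennreal_mult_strict_left_mono) auto
  also have "24 * (1 / 24) = (1::ennreal)"
    by (simp add: ennreal_times_divide)
  finally show False by simp
qed

theorem theorem3:
  shows "hausdorff_dim X_C = ereal alpha_star_X_C"
proof -
  have "hausdorff_dim X_C \<ge> ereal (log 4 3)"
    unfolding hausdorff_dim_def
    using hausdorff_measure_pos[OF _ _ C_subset_X_C]
    by (intro Inf_greatest) (force simp: not_le[symmetric])
  moreover have "hausdorff_dim X_C \<le> ereal (log 4 3)"
  proof (rule ereal_le_epsilon2)
    fix e :: real assume "e > 0"
    then have "hausdorff_measure (log 4 3 + e) X_C = 0" "0 \<le> log 4 3 + e"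
      using hausdorff_measure_X_C_eq_0[of "log 4 3 + e"] log_4_3 by auto
    then show "hausdorff_dim X_C \<le> ereal (log 4 3) + ereal e"
      unfolding hausdorff_dim_def by (intro Inf_lower) auto
  qed
  ultimately show ?thesis by (simp add: alpha_star_X_C_eq)
qed

end
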